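(* Let $R$ be a (not necessarily associative) ring with unit $1$, having multiplicative inverses, and satisfying the Hua identity $$a - \big(a^{-1} + (b^{-1} - a)^{-1}\big)^{-1} = (ab)a$$ for any nonzero elements $a,b\in R$ such that $a \ne b^{-1}$ and $a^{-1} + (b^{-1} - a)^{-1} \ne 0$, the identity being required for every admissible choice of the inverses involved. Then $R$ is alternative.
   Context: A ring here is an additive abelian group with a biadditive multiplication; it is not assumed to be associative, commutative, alternative, or to satisfy any other identity. A ring $R$ with two-sided unit $1$ has multiplicative inverses if for any nonzero $x\in R$ there is a (not necessarily unique) element $x^{-1}\in R$ such that $xx^{-1}=x^{-1}x=1$; any such element is called an inverse of $x$. Uniqueness of inverses is not assumed. The Hua identity is assumed for every admissible choice of inverses, that is: for all nonzero $a,b\in R$ and all $a',b',c,d\in R$ such that $a'$ is an inverse of $a$, $b'$ is an inverse of $b$, $b'-a\neq 0$, $c$ is an inverse of $b'-a$, $a'+c\ne 0$, and $d$ is an inverse of $a'+c$, one has $a-d=(ab)a$. A ring $R$ is alternative if $(xx)y=x(xy)$ and $(yx)x=y(xx)$ for all $x,y\in R$. *)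

theory Defs
  imports Main
begin

text \<open>
  The library's ring classes all include associativity of multiplication. The zero ring is not
  excluded: no axiom \<open>0 \<noteq> 1\<close> is imposed.
\<close>

class nonassoc_ring = ab_group_add + times +
  assumes nonassoc_distrib_left: "a * (b + c) = a * b + a * c"
    and nonassoc_distrib_right: "(a + b) * c = a * c + b * c"

class nonassoc_ring_1 = nonassoc_ring + one +
  assumes nonassoc_mult_1_left: "1 * a = a"
    and nonassoc_mult_1_right: "a * 1 = a"

definition is_inverse :: "'a::nonassoc_ring_1 \<Rightarrow> 'a \<Rightarrow> bool" where
  "is_inverse x y \<longleftrightarrow> x * y = 1 \<and> y * x = 1"

definition has_mult_inverses :: "'a::nonassoc_ring_1 itself \<Rightarrow> bool" where
  "has_mult_inverses _ \<longleftrightarrow> (\<forall>x::'a. x \<noteq> 0 \<longrightarrow> (\<exists>y. is_inverse x y))"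

text \<open>
  Inverses need not be unique, so the identity
  \<open>a - (a\<inverse> + (b\<inverse> - a)\<inverse>)\<inverse> = (a b) a\<close> is required for every choice \<open>a'\<close>, \<open>b'\<close>, \<open>c\<close>, \<open>d\<close> of
  the inverses of \<open>a\<close>, \<open>b\<close>, \<open>b' - a\<close>, \<open>a' + c\<close>.
\<close>

definition hua_identity :: "'a::nonassoc_ring_1 itself \<Rightarrow> bool" where
  "hua_identity _ \<longleftrightarrow>
    (\<forall>(a::'a) b a' b' c d.
      a \<noteq> 0 \<longrightarrow> b \<noteq> 0 \<longrightarrow> is_inverse a a' \<longrightarrow> is_inverse b b' \<longrightarrow>
      b' - a \<noteq> 0 \<longrightarrow> is_inverse (b' - a) c \<longrightarrow>
      a' + c \<noteq> 0 \<longrightarrow> is_inverse (a' + c) d \<longrightarrow>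
      a - d = (a * b) * a)"

definition alternative :: "'a::nonassoc_ring itself \<Rightarrow> bool" where
  "alternative _ \<longleftrightarrow>
    (\<forall>(x::'a) y. (x * x) * y = x * (x * y) \<and> (y * x) * x = y * (x * x))"

end

theory Submission
  imports Defs
begin

text \<open>
  The Hua identity forces inverses to be unique and yields the right inverse property
  \<open>(a x\<inverse>) x = a\<close>; right multiplications then satisfy the Hua identity themselves, whence the right
  Moufang identity. Suppose that \<open>w = (x, x, y) \<noteq> 0\<close>. The map \<open>\<delta> v = (v, x, y)\<close> and its reversal
  \<open>\<delta>'\<close> satisfy \<open>\<delta> \<delta>' = \<delta>' \<delta> = 0\<close>, and \<open>\<delta> + \<delta>'\<close> is right multiplication by \<open>[y, x]\<close>, which may be
  assumed to be nonzero. Hence the ring is a direct sum of \<open>A = ker \<delta>\<close> and \<open>V = ker \<delta>'\<close>, with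
  \<open>A A \<subseteq> A\<close>, \<open>A V \<subseteq> V\<close>, \<open>V V \<subseteq> A\<close>. The pair \<open>(x, y x)\<close> gives the same \<open>A\<close>, but a complement
  containing \<open>j + 1\<close> for some \<open>0 \<noteq> j \<in> V\<close>; so \<open>(j + 1)\<^sup>2\<close> and \<open>j\<^sup>2\<close> lie in \<open>A\<close> and \<open>2 = 0\<close>. In
  characteristic two the ring is an inseparable doubling \<open>A + A j\<close> in which \<open>j\<close> turns out to commute
  with everything. Then \<open>(j, x, y) = 0\<close>, which contradicts \<open>j \<notin> A\<close>.
\<close>

section \<open>Arithmetic in nonassociative rings\<close>

lemma nonassoc_mult_zero_left [simp]: "0 * a = (0 :: 'a::nonassoc_ring)"
  using nonassoc_distrib_right[of 0 0 a] by simp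

lemma nonassoc_mult_zero_right [simp]: "a * 0 = (0 :: 'a::nonassoc_ring)"
  using nonassoc_distrib_left[of a 0 0] by simp

lemma nonassoc_minus_left [simp]: "(- a) * b = - (a * b :: 'a::nonassoc_ring)"
  using nonassoc_distrib_right[of "- a" a b] by (simp add: eq_neg_iff_add_eq_0)

lemma nonassoc_minus_right [simp]: "a * (- b) = - (a * b :: 'a::nonassoc_ring)"
  using nonassoc_distrib_left[of a "- b" b] by (simp add: eq_neg_iff_add_eq_0)

lemma nonassoc_diff_left: "(a - b) * c = a * c - b * (c :: 'a::nonassoc_ring)"
  using nonassoc_distrib_right[of a "- b" c] by simp

lemma nonassoc_diff_right: "c * (a - b) = c * a - c * (b :: 'a::nonassoc_ring)"
  using nonassoc_distrib_left[of c a "- b"] by simp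

lemmas nonassoc_distribs =
  nonassoc_distrib_left nonassoc_distrib_right nonassoc_diff_left nonassoc_diff_right

declare nonassoc_mult_1_left [simp] nonassoc_mult_1_right [simp]

section \<open>From the Hua identity to the right Moufang identity\<close>

lemma is_inverse_sym: "is_inverse x y \<longleftrightarrow> is_inverse y x"
  by (auto simp: is_inverse_def)

lemma is_inverse_minus: "is_inverse x y \<Longrightarrow> is_inverse (- x) (- y)"
  by (simp add: is_inverse_def)

lemma is_inverse_nonzero: "is_inverse x y \<Longrightarrow> x \<noteq> 0 \<Longrightarrow> y \<noteq> 0"
  by (metis is_inverse_def nonassoc_mult_1_right nonassoc_mult_zero_right)

locale hua_ring =
  fixes T :: "'a::nonassoc_ring_1 itself"
  assumes inverses: "has_mult_inverses TYPE('a)"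
    and hua: "hua_identity TYPE('a)"
begin

lemma inverse_exists:
  fixes x :: 'a
  assumes "x \<noteq> 0"
  obtains y where "is_inverse x y"
  using assms inverses by (auto simp: has_mult_inverses_def)

lemma hua_rule:
  fixes a b :: 'a
  assumes "a \<noteq> 0" "b \<noteq> 0" "is_inverse a a'" "is_inverse b b'" "b' - a \<noteq> 0"
    "is_inverse (b' - a) c" "a' + c \<noteq> 0" "is_inverse (a' + c) d"
  shows "a - d = (a * b) * a"
  using hua assms unfolding hua_identity_def by blast

text \<open>For \<open>a = 1\<close> the Hua identity determines \<open>d\<close> from
  \<open>b\<close>. With \<open>y\<close> an inverse of \<open>x - 1\<close> and \<open>b\<close> an
  inverse of \<open>y + 1\<close>, every inverse of \<open>x\<close> is admissible as
  \<open>d\<close>.\<close>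

lemma inverse_unique:
  fixes x :: 'a
  assumes x: "x \<noteq> 0" and d: "is_inverse x d" and e: "is_inverse x e"
  shows "d = e"
proof (cases "x = 1")
  case True
  then show ?thesis using d e by (simp add: is_inverse_def)
next
  case False
  then obtain y where y: "is_inverse (x - 1) y"
    using inverse_exists[of "x - 1"] by auto
  have y0: "y \<noteq> 0" using is_inverse_nonzero[OF y] False by simp
  have y1: "y + 1 \<noteq> 0"
  proof
    assume "y + 1 = 0"
    then have "y = - 1" by (simp add: eq_neg_iff_add_eq_0)
    then have "- (x - 1) = 1" using y by (simp add: is_inverse_def)
    then have "x = 0" by (metis minus_equation_iff diff_add_cancel add.left_inverse)
    then show False using x by simp
  qed
  obtain b where b: "is_inverse b (y + 1)"
    using inverse_exists[OF y1] is_inverse_sym by blast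
  have b0: "b \<noteq> 0" using is_inverse_nonzero b y1 is_inverse_sym by blast
  have one: "(1::'a) \<noteq> 0" using x by (metis nonassoc_mult_1_right nonassoc_mult_zero_right)
  have "1 - z = (1 * b) * 1" if "is_inverse x z" for z
    by (rule hua_rule[of 1 b 1 "y + 1" "x - 1"])
      (use one b0 b y0 y x that in \<open>simp_all add: is_inverse_def\<close>)
  from this[OF d] this[OF e] show ?thesis by (metis add_diff_cancel_left' diff_add_cancel)
qed

text \<open>
  The two sides of \<open>(a\<inverse> + (x - a)\<inverse>)\<inverse>\<close> being symmetric in \<open>a\<close> and \<open>x - a\<close>, comparing the Hua
  identities for \<open>(a, x\<inverse>)\<close> and \<open>(x - a, x\<inverse>)\<close> eliminates this inverse.
\<close>

lemma right_inverse_property: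
  fixes a x s :: 'a
  assumes x: "x \<noteq> 0" and s: "is_inverse x s"
  shows "(a * s) * x = a"
proof (cases "a = 0 \<or> a = x")
  case True
  then show ?thesis using s by (auto simp: is_inverse_def)
next
  case False
  define c where "c = x - a"
  have a0: "a \<noteq> 0" and c0: "c \<noteq> 0" using False by (auto simp: c_def)
  have xac: "x - a = c" "x - c = a" by (simp_all add: c_def)
  obtain a' where a': "is_inverse a a'" using inverse_exists[OF a0] .
  obtain c' where c': "is_inverse c c'" using inverse_exists[OF c0] .
  have s0: "s \<noteq> 0" using is_inverse_nonzero s x by blast
  have sx: "is_inverse s x" using s is_inverse_sym by blast
  have n: "a' + c' \<noteq> 0"
  proof
    assume "a' + c' = 0"
    then have "c' = - a'" by (simp add: eq_neg_iff_add_eq_0 add.commute)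
    then have "is_inverse c' (- a)" using is_inverse_minus[OF a'] is_inverse_sym by blast
    moreover have "is_inverse c' c" "c' \<noteq> 0"
      using c' c0 is_inverse_sym is_inverse_nonzero by blast+
    ultimately have "c = - a" using inverse_unique by blast
    then show False using x by (simp add: c_def)
  qed
  obtain d where d: "is_inverse (a' + c') d" using inverse_exists[OF n] .
  have 1: "a - d = (a * s) * a"
    by (rule hua_rule[OF a0 s0 a' sx]) (use c0 c' n d in \<open>simp_all add: xac\<close>)
  have 2: "c - d = (c * s) * c"
    by (rule hua_rule[OF c0 s0 c' sx]) (use a0 a' n d in \<open>simp_all add: xac add.commute\<close>)
  have xs: "x * s = 1" using s by (simp add: is_inverse_def)
  have "(a * s) * x - a = ((a * s) * a - (a - d)) - ((c * s) * c - (c - d))"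
    by (simp add: c_def nonassoc_distribs xs algebra_simps)
  then show ?thesis using 1 2 by simp
qed

lemma right_inverse_property':
  fixes a x s :: 'a
  assumes "x \<noteq> 0" and "is_inverse x s"
  shows "(a * x) * s = a"
  using right_inverse_property[of s x] is_inverse_nonzero[OF assms(2,1)] is_inverse_sym assms(2)
  by blast

text \<open>
  By the right inverse property the right multiplications satisfy the Hua identity in the
  associative ring of additive maps.
\<close>

lemma right_moufang_if_hua:
  fixes a b x :: 'a
  shows "((x * a) * b) * a = x * ((a * b) * a)"
proof (cases "a = 0 \<or> b = 0")
  case True
  then show ?thesis by auto
next
  case False
  then have a0: "a \<noteq> 0" and b0: "b \<noteq> 0" by auto
  obtain a' where a': "is_inverse a a'" using inverse_exists[OF a0] .
  obtain b' where b': "is_inverse b b'" using inverse_exists[OF b0] .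
  show ?thesis
  proof (cases "b' - a = 0")
    case True
    then have "is_inverse a b" using b' is_inverse_sym by auto
    then show ?thesis using right_inverse_property'[OF a0] by (simp add: is_inverse_def)
  next
    case False
    then obtain c where c: "is_inverse (b' - a) c" using inverse_exists by blast
    have n: "a' + c \<noteq> 0"
    proof
      assume "a' + c = 0"
      then have "c = - a'" by (simp add: eq_neg_iff_add_eq_0 add.commute)
      then have "is_inverse c (- a)" using is_inverse_minus[OF a'] is_inverse_sym by blast
      moreover have "is_inverse c (b' - a)" "c \<noteq> 0"
        using c False is_inverse_sym is_inverse_nonzero by blast+
      ultimately have "b' - a = - a" using inverse_unique by blast
      then show False using is_inverse_nonzero[OF b' b0] by simp
    qed
    obtain d where d: "is_inverse (a' + c) d" using inverse_exists[OF n] .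
    have h: "a - d = (a * b) * a" by (rule hua_rule[OF a0 b0 a' b' False c n d])
    \<comment> \<open>Multiplying \<open>y - (y * b) * a\<close> by \<open>a'\<close> gives
      \<open>x - y * b\<close>, and by \<open>c\<close> gives \<open>y * b\<close>; so
      \<open>a' + c\<close> takes it to \<open>x\<close>, and it equals
      \<open>x * d\<close>.\<close>
    define y where "y = x * a"
    have 1: "y * a' = x" "((y * b) * a) * a' = y * b"
      using right_inverse_property'[OF a0 a'] by (simp_all add: y_def)
    have 2: "(y - (y * b) * a) * c = y * b"
    proof -
      have "y - (y * b) * a = (y * b) * (b' - a)"
        using right_inverse_property'[OF b0 b'] by (simp add: nonassoc_distribs)
      then show ?thesis using right_inverse_property'[OF False c] by simp
    qed
    have "(y - (y * b) * a) * (a' + c) = x"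
      using 1 2 by (simp add: nonassoc_distrib_left nonassoc_diff_left[of _ _ a'])
    then have "y - (y * b) * a = x * d"
      using right_inverse_property'[OF n d] by metis
    moreover have "x * d = x * a - x * ((a * b) * a)"
      by (simp add: h[symmetric] nonassoc_distribs)
    ultimately show ?thesis by (simp add: y_def)
  qed
qed

end


section \<open>Right Moufang rings with inverses\<close>

locale right_moufang_division =
  fixes T :: "'a::nonassoc_ring_1 itself"
  assumes moufang: "(((x::'a) * a) * b) * a = x * ((a * b) * a)"
    and right_inverse_ex:
      "(a::'a) \<noteq> 0 \<Longrightarrow> \<exists>a'. is_inverse a a' \<and> (\<forall>x. (x * a) * a' = x \<and> (x * a') * a = x)"
begin

lemma right_alternative: "(x * a) * a = x * (a * a)" for x a :: 'a
  using moufang[of x a 1] by simp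

lemma right_alternative_lin: "x * (a * b) + x * (b * a) = (x * a) * b + (x * b) * a" for x a b :: 'a
proof -
  have "(x * (a * b) + x * (b * a)) - ((x * a) * b + (x * b) * a)
    = (x * ((a + b) * (a + b)) - (x * (a + b)) * (a + b))
      - (x * (a * a) - (x * a) * a) - (x * (b * b) - (x * b) * b)"
    by (simp add: nonassoc_distribs algebra_simps)
  then show ?thesis by (simp add: right_alternative)
qed

lemma moufang_lin:
  "((x * a) * b) * c + ((x * c) * b) * a = x * ((a * b) * c) + x * ((c * b) * a)" for x a b c :: 'a
proof -
  have "(((x * a) * b) * c + ((x * c) * b) * a) - (x * ((a * b) * c) + x * ((c * b) * a))
    = (((x * (a + c)) * b) * (a + c) - x * (((a + c) * b) * (a + c)))
      - (((x * a) * b) * a - x * ((a * b) * a)) - (((x * c) * b) * c - x * ((c * b) * c))"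
    by (simp add: nonassoc_distribs algebra_simps)
  then show ?thesis by (simp add: moufang)
qed

lemma mult_eq_0: "x * y = 0 \<Longrightarrow> y \<noteq> 0 \<Longrightarrow> x = 0" for x y :: 'a
  using right_inverse_ex[of y] by (metis nonassoc_mult_zero_left)

lemma right_cancel: "x * y = z * y \<Longrightarrow> y \<noteq> 0 \<Longrightarrow> x = z" for x y z :: 'a
  using right_inverse_ex[of y] by metis

text \<open>
  With \<open>R a\<close> for right multiplication, \<open>assoc_map x y = R y R x - R (x y)\<close> is \<open>v \<mapsto> (v, x, y)\<close>, and
  \<open>assoc_map_rev x y = R x R y - R (x y)\<close> is its image under the involution fixing all \<open>R a\<close>.
\<close>

definition assoc_map :: "'a \<Rightarrow> 'a \<Rightarrow> 'a \<Rightarrow> 'a" where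
  "assoc_map x y v = (v * x) * y - v * (x * y)"

definition assoc_map_rev :: "'a \<Rightarrow> 'a \<Rightarrow> 'a \<Rightarrow> 'a" where
  "assoc_map_rev x y v = (v * y) * x - v * (x * y)"

lemma assoc_map_additive:
  "assoc_map x y (u + v) = assoc_map x y u + assoc_map x y v"
  "assoc_map x y (u - v) = assoc_map x y u - assoc_map x y v"
  "assoc_map x y (- v) = - assoc_map x y v"
  "assoc_map x y 0 = 0"
  "assoc_map x y 1 = 0"
  by (simp_all add: assoc_map_def nonassoc_distribs)

lemma assoc_map_rev_additive:
  "assoc_map_rev x y (u + v) = assoc_map_rev x y u + assoc_map_rev x y v"
  "assoc_map_rev x y (u - v) = assoc_map_rev x y u - assoc_map_rev x y v"
  "assoc_map_rev x y (- v) = - assoc_map_rev x y v"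
  "assoc_map_rev x y 0 = 0"
  "assoc_map_rev x y 1 = y * x - x * y"
  by (simp_all add: assoc_map_rev_def nonassoc_distribs)

lemma assoc_map_sum: "assoc_map x y v + assoc_map_rev x y v = v * (y * x - x * y)"
proof -
  have "(assoc_map x y v + assoc_map_rev x y v) - v * (y * x - x * y)
    = (v * x) * y + (v * y) * x - (v * (x * y) + v * (y * x))"
    by (simp add: assoc_map_def assoc_map_rev_def nonassoc_distribs algebra_simps)
  then show ?thesis by (simp add: right_alternative_lin)
qed

text \<open>Right alternativity and Moufang, the latter also linearised at \<open>x, y, p\<close>,
  turn everything into right multiplications; these cancel since
  \<open>x * (y * y) = p * y\<close>.\<close>

lemma assoc_map_rev_assoc_map: "assoc_map_rev x y (assoc_map x y v) = 0"
proof -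
  define p where "p = x * y"
  have "assoc_map_rev x y (assoc_map x y v) =
      (((v * x) * y) * y) * x - (((v * x) * y) * p + ((v * p) * y) * x) + (v * p) * p"
    by (simp add: assoc_map_def assoc_map_rev_def p_def nonassoc_distribs algebra_simps)
  also have "(((v * x) * y) * y) * x = v * ((p * y) * x)"
    using right_alternative[of "v * x" y] right_alternative[of x y] moufang[of v x "y * y"]
    by (simp add: p_def)
  also have "((v * x) * y) * p + ((v * p) * y) * x = v * (p * p) + v * ((p * y) * x)"
    using moufang_lin[of v x y p] by (simp add: p_def)
  finally show ?thesis by (simp add: right_alternative)
qed

text \<open>In this order the computation leaves right multiplication by some \<open>z\<close>. Its
  square contains the opposite composite, so \<open>z * z = 0\<close>, and there are no zero
  divisors.\<close>

lemma assoc_map_assoc_map_rev: "assoc_map x y (assoc_map_rev x y v) = 0"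
proof -
  define p where "p = x * y"
  define z where "z = (y * (x * x)) * y - (y * x) * p - (p * x) * y + p * p"
  have *: "assoc_map x y (assoc_map_rev x y v) = v * z" for v
  proof -
    have "assoc_map x y (assoc_map_rev x y v) =
        (((v * y) * x) * x) * y - (((v * y) * x) * p + ((v * p) * x) * y) + (v * p) * p"
      by (simp add: assoc_map_def assoc_map_rev_def p_def nonassoc_distribs algebra_simps)
    also have "(((v * y) * x) * x) * y = v * ((y * (x * x)) * y)"
      using right_alternative[of "v * y" x] moufang[of v y "x * x"] by simp
    also have "((v * y) * x) * p + ((v * p) * x) * y = v * ((y * x) * p) + v * ((p * x) * y)"
      using moufang_lin[of v y x p] .
    finally show ?thesis
      by (simp add: right_alternative z_def nonassoc_distribs algebra_simps)
  qed
  have "z * z = (1 * z) * z" by simp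
  also have "\<dots> = 0"
    unfolding *[symmetric] by (simp add: assoc_map_rev_assoc_map assoc_map_additive)
  finally have "z = 0" using mult_eq_0 by blast
  then show ?thesis by (simp add: *)
qed

text \<open>Linearised Moufang minus linearised right alternativity. This rule governs all products
  of elements of the two kernels.\<close>

lemma assoc_map_mult:
  "assoc_map x y z * c = z * assoc_map_rev x y c - assoc_map_rev x y (z * c)"
proof -
  define p where "p = x * y"
  have "z * assoc_map_rev x y c - assoc_map_rev x y (z * c) - assoc_map x y z * c
    = (z * ((x * y) * c) + z * ((c * y) * x) - (((z * x) * y) * c + ((z * c) * y) * x))
      - (z * (p * c) + z * (c * p) - ((z * p) * c + (z * c) * p))"
    by (simp add: assoc_map_def assoc_map_rev_def p_def nonassoc_distribs algebra_simps)
  then show ?thesis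
    unfolding right_alternative_lin moufang_lin[symmetric] by simp
qed

lemma assoc_map_mult_left: "assoc_map x (x * y) v = assoc_map x y v * x"
proof -
  define p where "p = x * y"
  have "assoc_map x p v - assoc_map x y v * x
    = ((v * x) * p + (v * p) * x - (v * (x * p) + v * (p * x)))
      - (((v * x) * y) * x - v * ((x * y) * x))"
    by (simp add: assoc_map_def p_def nonassoc_distribs algebra_simps)
  then show ?thesis unfolding right_alternative_lin moufang by (simp add: p_def)
qed

lemma mult_mult_commute:
  "x * (y * x) = (x * y) * x + assoc_map x y x"
  using right_alternative_lin[of x x y]
  by (simp add: assoc_map_def algebra_simps)

text \<open>This and the next lemma compare the maps of the pair \<open>x, y * x\<close> with those
  of \<open>x, y\<close>.\<close>

lemma assoc_map_mult_right:
  "assoc_map x (y * x) v = assoc_map x y (v * x) - v * assoc_map x y x"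
proof -
  have "assoc_map x (y * x) v - (assoc_map x y (v * x) - v * assoc_map x y x)
    = ((v * x) * (y * x) + (v * x) * (x * y) - (((v * x) * y) * x + ((v * x) * x) * y))
      + (((v * x) * y) * x - v * ((x * y) * x))"
    by (simp add: assoc_map_def[of x "y * x"] assoc_map_def[of x y "v * x"] mult_mult_commute
        nonassoc_distribs algebra_simps)
  then show ?thesis unfolding right_alternative_lin moufang by simp
qed

lemma assoc_map_rev_mult_right:
  "assoc_map_rev x (y * x) v = assoc_map_rev x y v * x - v * assoc_map x y x"
proof -
  have "assoc_map_rev x (y * x) v - (assoc_map_rev x y v * x - v * assoc_map x y x)
    = (v * (x * y) + v * (y * x) - ((v * x) * y + (v * y) * x)) * x
      + (((v * x) * y) * x - v * ((x * y) * x))"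
    by (simp add: assoc_map_rev_def mult_mult_commute nonassoc_distribs algebra_simps)
  then show ?thesis unfolding right_alternative_lin moufang by simp
qed

section \<open>Splitting the ring into the two kernels\<close>

context
  fixes x y :: 'a
  assumes noncomm: "y * x - x * y \<noteq> 0"
begin

text \<open>Right multiplication by the commutator is the sum of the two maps, whose mixed
  composites vanish.\<close>

lemma assoc_map_rev_commutator:
  "assoc_map_rev x y (v * (y * x - x * y)) = assoc_map_rev x y v * (y * x - x * y)"
  by (simp add: assoc_map_sum[symmetric] assoc_map_rev_additive assoc_map_rev_assoc_map
      assoc_map_assoc_map_rev)

lemma kernels_disjoint: "assoc_map x y v = 0 \<Longrightarrow> assoc_map_rev x y v = 0 \<Longrightarrow> v = 0"
  using assoc_map_sum[of x y v] noncomm mult_eq_0 by simp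

lemma divide_by_commutator:
  obtains u where "v = u * (y * x - x * y)"
    and "assoc_map_rev x y v = 0 \<Longrightarrow> assoc_map_rev x y u = 0"
proof -
  obtain k' where k': "(v * k') * (y * x - x * y) = v"
    using right_inverse_ex[OF noncomm] by blast
  show ?thesis
  proof (rule that[of "v * k'"])
    show "assoc_map_rev x y (v * k') = 0" if "assoc_map_rev x y v = 0"
      using assoc_map_rev_commutator[of "v * k'"] k' that mult_eq_0 noncomm by metis
  qed (simp add: k')
qed

lemma kernel_decomposition:
  obtains a u where "v = a + u" "assoc_map x y a = 0" "assoc_map_rev x y u = 0"
proof -
  obtain z where z: "v = z * (y * x - x * y)" using divide_by_commutator by blast
  show ?thesis
    by (rule that[of "assoc_map_rev x y z" "assoc_map x y z"])
      (simp_all add: z assoc_map_sum[symmetric] assoc_map_rev_assoc_map assoc_map_assoc_map_rev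
        add.commute)
qed

lemma kernel_mult_kernel_rev:
  "assoc_map x y c = 0 \<Longrightarrow> assoc_map_rev x y v = 0 \<Longrightarrow> assoc_map_rev x y (c * v) = 0"
  using assoc_map_mult[of x y c v] by simp

lemma kernel_rev_mult_kernel_rev:
  assumes u: "assoc_map_rev x y u = 0" and v: "assoc_map_rev x y v = 0"
  shows "assoc_map x y (u * v) = 0"
proof -
  obtain z where z: "u = z * (y * x - x * y)" and "assoc_map_rev x y z = 0"
    using divide_by_commutator u by blast
  then have "u = assoc_map x y z" using assoc_map_sum[of x y z] by simp
  then have "u * v = assoc_map_rev x y (- (z * v))"
    using assoc_map_mult[of x y z v] v by (simp add: assoc_map_rev_additive)
  then show ?thesis by (simp add: assoc_map_assoc_map_rev)
qed

text \<open>It suffices to write \<open>d\<close> as \<open>assoc_map_rev x y a\<close> with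
  \<open>a\<close> in the kernel of \<open>assoc_map x y\<close>: then \<open>c * d\<close> is the
  image of \<open>c * a\<close>.\<close>

lemma kernel_mult_kernel:
  assumes c: "assoc_map x y c = 0" and d: "assoc_map x y d = 0"
  shows "assoc_map x y (c * d) = 0"
proof -
  obtain z where z: "d = z * (y * x - x * y)" using divide_by_commutator by blast
  obtain a u where zau: "z = a + u" and a: "assoc_map x y a = 0" and u: "assoc_map_rev x y u = 0"
    using kernel_decomposition .
  have "d = assoc_map_rev x y a + assoc_map x y u"
    using z a u by (simp add: zau assoc_map_sum[symmetric] assoc_map_additive
        assoc_map_rev_additive add.commute)
  moreover have "assoc_map x y u = 0"
  proof (rule kernels_disjoint)
    show "assoc_map x y (assoc_map x y u) = 0"
      using d calculation by (simp add: assoc_map_additive assoc_map_assoc_map_rev)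
  qed (simp add: assoc_map_rev_assoc_map)
  ultimately have "c * d = assoc_map_rev x y (c * a)"
    using assoc_map_mult[of x y c a] c by simp
  then show ?thesis by (simp add: assoc_map_assoc_map_rev)
qed

end

end

section \<open>Inseparable doublings in characteristic two\<close>

text \<open>\<open>A\<close> and \<open>V\<close> are the even and odd parts of a splitting;
  \<open>shift\<close> is the trace of a second splitting with the same \<open>A\<close>, whose odd
  part contains \<open>j + 1\<close>.\<close>

locale inseparable_doubling = right_moufang_division T
  for T :: "'a::nonassoc_ring_1 itself" +
  fixes A V :: "'a set" and j :: 'a
  assumes two: "(z::'a) + z = 0"
    and A_add: "a \<in> A \<Longrightarrow> b \<in> A \<Longrightarrow> a + b \<in> A"
    and A_one: "1 \<in> A"
    and A_mult: "a \<in> A \<Longrightarrow> b \<in> A \<Longrightarrow> a * b \<in> A"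
    and V_add: "u \<in> V \<Longrightarrow> v \<in> V \<Longrightarrow> u + v \<in> V"
    and A_mult_V: "a \<in> A \<Longrightarrow> v \<in> V \<Longrightarrow> a * v \<in> V"
    and V_mult_V: "u \<in> V \<Longrightarrow> v \<in> V \<Longrightarrow> u * v \<in> A"
    and disjoint: "a \<in> A \<Longrightarrow> a \<in> V \<Longrightarrow> a = 0"
    and decomposition: "\<exists>a\<in>A. \<exists>v\<in>V. z = a + v"
    and j_V: "j \<in> V"
    and j_nonzero: "j \<noteq> 0"
    and shift: "a \<in> A \<Longrightarrow> b \<in> A \<Longrightarrow> (a * (j + 1)) * (b * (j + 1)) \<in> A"
begin

lemma two': "x + (x + y) = y" for x y :: 'a
  by (metis two add.assoc add_0)

lemma eq_if_sum_eq_0: "x + y = 0 \<Longrightarrow> x = y" for x y :: 'a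
  by (metis two' add_0_right)

lemmas char2 = two two' add.assoc add.commute add.left_commute

lemma zero_A: "0 \<in> A"
  using A_add[OF A_one A_one] by (simp add: two)

lemma zero_V: "0 \<in> V"
  using V_add[OF j_V j_V] by (simp add: two)

lemma components_unique:
  assumes "a \<in> A" "b \<in> A" "u \<in> V" "v \<in> V" "a + u = b + v"
  shows "a = b" "u = v"
proof -
  have eq: "a + b = u + v"
    using assms(5) by (metis two' add.assoc add.commute)
  have "a + b \<in> A" "a + b \<in> V"
    using assms A_add V_add by (simp, simp add: eq)
  then have "a + b = 0" by (rule disjoint)
  then show "a = b" "u = v" using eq eq_if_sum_eq_0 by metis+
qed

lemma A_mult_j: "a \<in> A \<Longrightarrow> a * j \<in> V"
  using A_mult_V j_V by blast

lemma V_eq: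
  assumes "v \<in> V" obtains d where "d \<in> A" "v = d * j"
proof -
  obtain z where z: "z * j = v" using right_inverse_ex[OF j_nonzero] by metis
  obtain a u where au: "a \<in> A" "u \<in> V" "z = a + u" using decomposition by blast
  have "u * j + a * j = 0 + v" using z au by (simp add: nonassoc_distribs add.commute)
  then have "u * j = 0" "a * j = v"
    using components_unique[of "u * j" 0 "a * j" v] V_mult_V[OF au(2) j_V] A_mult_j[OF au(1)] assms
      zero_A
    by auto
  then show ?thesis using that au by metis
qed

text \<open>In characteristic two \<open>B\<close> is the commutator with \<open>j\<close>. The aim
  is \<open>B = 0\<close> on \<open>A\<close> and \<open>n e = e * s\<close>, which make
  \<open>j\<close> commute with everything.\<close>

definition B :: "'a \<Rightarrow> 'a" where "B b = j * b + b * j"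
definition s :: 'a where "s = j * j"
definition n :: "'a \<Rightarrow> 'a" where "n e = j * (e * j)"

lemma B_add: "B (a + b) = B a + B b"
  by (simp add: B_def nonassoc_distribs char2)

lemma shift_A:
  assumes "c \<in> A" "b \<in> A" shows "(c * j) * b + c * (b * j) \<in> A"
proof -
  have "(c * j) * b + c * (b * j)
      = (c * (j + 1)) * (b * (j + 1)) + ((c * j) * (b * j) + c * b)"
    by (simp add: nonassoc_distribs char2)
  then show ?thesis using shift A_add V_mult_V A_mult A_mult_j assms by simp
qed

lemma B_A: "b \<in> A \<Longrightarrow> B b \<in> A"
  using shift_A[OF A_one] by (simp add: B_def)

lemma s_A: "s \<in> A"
  using V_mult_V j_V by (simp add: s_def)

lemma n_A: "e \<in> A \<Longrightarrow> n e \<in> A"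
  using V_mult_V j_V A_mult_j by (simp add: n_def)

lemma mult_B: "c * B b = (c * j) * b + (c * b) * j"
  using right_alternative_lin[of c j b] by (simp add: B_def nonassoc_distribs)

text \<open>Adding \<open>c * B b\<close> to the element of \<open>shift_A\<close> cancels
  \<open>(c * j) * b\<close>; what remains lies in both \<open>A\<close> and
  \<open>V\<close>.\<close>

lemma A_mult_Aj:
  assumes "c \<in> A" "b \<in> A" shows "c * (b * j) = (c * b) * j"
proof -
  have "((c * j) * b + c * (b * j)) + c * B b = c * (b * j) + (c * b) * j"
    by (simp add: mult_B char2)
  moreover have "((c * j) * b + c * (b * j)) + c * B b \<in> A"
    using shift_A B_A A_mult A_add assms by simp
  moreover have "c * (b * j) + (c * b) * j \<in> V"
    using V_add A_mult_V A_mult_j A_mult assms by simp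
  ultimately show ?thesis using disjoint eq_if_sum_eq_0 by metis
qed

lemma Aj_mult_A: "(c * j) * b = (c * b) * j + c * B b"
  by (simp add: mult_B char2)

lemma j_mult_A: "j * b = b * j + B b"
  using Aj_mult_A[of 1 b] by simp

lemma Aj_mult_j: "(b * j) * j = b * s"
  by (simp add: right_alternative s_def)

text \<open>Moufang for the middle factor \<open>c\<close> between two factors \<open>j\<close>,
  applied to \<open>b\<close> and to \<open>b * j\<close>.\<close>

lemma
  assumes b: "b \<in> A" and c: "c \<in> A"
  shows A_A_s: "(b * c) * s = b * (c * s)" and A_s_A: "(b * s) * c = b * (c * s)"
proof -
  have jcj: "(j * c) * j = c * s + B c * j"
    by (simp add: j_mult_A nonassoc_distribs Aj_mult_j)
  note mem = b c s_A B_A A_mult A_add A_mult_j V_mult_V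
  have "(b * c) * s + (b * B c) * j = ((b * j) * c) * j"
    by (simp add: Aj_mult_A[of b c] nonassoc_distribs Aj_mult_j)
  also have "\<dots> = b * (c * s + B c * j)"
    by (simp only: moufang jcj)
  also have "\<dots> = b * (c * s) + (b * B c) * j"
    using A_mult_Aj[of b "B c"] mem by (simp add: nonassoc_distribs)
  finally show "(b * c) * s = b * (c * s)" by simp
  have "0 + ((b * s) * c) * j = (((b * j) * j) * c) * j"
    by (simp add: Aj_mult_j)
  also have "\<dots> = (b * j) * (c * s + B c * j)"
    by (simp only: moufang jcj)
  also have "\<dots> = ((b * j) * (B c * j) + b * B (c * s)) + (b * (c * s)) * j"
    by (simp only: nonassoc_distribs Aj_mult_A[of b "c * s"]) (simp add: char2)
  finally have "((b * s) * c) * j = (b * (c * s)) * j"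
    by (rule components_unique(2)[rotated -1]) (use mem zero_A in auto)
  then show "(b * s) * c = b * (c * s)" using right_cancel j_nonzero by blast
qed

text \<open>Comparison of \<open>V\<close>-parts in linearised right alternativity at
  \<open>b * j\<close>, \<open>j\<close>, \<open>e * j\<close>.\<close>

lemma Aj_mult_Aj:
  assumes b: "b \<in> A" and e: "e \<in> A"
  shows "(b * j) * (e * j) = b * n e"
proof -
  note mem = b e s_A n_A B_A A_mult A_add A_mult_j V_mult_V
  have "(b * j) * (n e + e * s) = ((b * s) * e) * j + ((b * j) * (e * j)) * j"
    using right_alternative_lin[of "b * j" j "e * j"] A_mult_Aj[of "b * s" e] mem
    by (simp add: n_def nonassoc_distribs Aj_mult_j)
  then have "b * B (n e + e * s) + (b * (n e + e * s)) * j
      = 0 + ((b * s) * e + (b * j) * (e * j)) * j"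
    by (simp add: Aj_mult_A[of b "n e + e * s"] nonassoc_distrib_right add.commute)
  then have "(b * (n e + e * s)) * j = ((b * s) * e + (b * j) * (e * j)) * j"
    by (rule components_unique(2)[rotated -1]) (use mem zero_A in auto)
  then have "b * (n e + e * s) = (b * s) * e + (b * j) * (e * j)"
    using right_cancel j_nonzero by blast
  then have "b * n e + b * (e * s) = b * (e * s) + (b * j) * (e * j)"
    using b e by (simp add: A_s_A nonassoc_distribs)
  then show ?thesis by (metis add.commute add_left_cancel)
qed

text \<open>The two parts of linearised right alternativity at \<open>b * j\<close>,
  \<open>c\<close>, \<open>e * j\<close>.\<close>

lemma
  assumes b: "b \<in> A" and c: "c \<in> A" and e: "e \<in> A"
  shows A_B_A: "(b * B c) * e = b * (e * B c)"
    and n_mult_lin: "b * n (c * e) + b * n (e * c) + b * B (e * B c) = (b * c) * n e + (b * n e) * c"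
proof -
  note mem = b c e s_A n_A B_A A_mult A_add A_mult_j V_mult_V
  have "(b * j) * (c * (e * j)) + (b * j) * ((e * j) * c)
      = (b * n (c * e) + b * n (e * c) + b * B (e * B c)) + (b * (e * B c)) * j"
    using mem by (simp add: A_mult_Aj Aj_mult_A[of e c] Aj_mult_A[of b "e * B c"] Aj_mult_Aj
        nonassoc_distribs char2)
  moreover have "((b * j) * c) * (e * j) + ((b * j) * (e * j)) * c
      = ((b * c) * n e + (b * n e) * c) + ((b * B c) * e) * j"
    using mem by (simp add: A_mult_Aj Aj_mult_A[of b c] Aj_mult_Aj nonassoc_distribs char2)
  ultimately have
    *: "(b * n (c * e) + b * n (e * c) + b * B (e * B c)) + (b * (e * B c)) * j
      = ((b * c) * n e + (b * n e) * c) + ((b * B c) * e) * j"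
    by (simp only: right_alternative_lin)
  show "b * n (c * e) + b * n (e * c) + b * B (e * B c) = (b * c) * n e + (b * n e) * c"
    by (rule components_unique(1)[OF _ _ _ _ *]) (use mem in auto)
  have "(b * (e * B c)) * j = ((b * B c) * e) * j"
    by (rule components_unique(2)[OF _ _ _ _ *]) (use mem in auto)
  then show "(b * B c) * e = b * (e * B c)" using right_cancel j_nonzero by metis
qed

text \<open>The \<open>V\<close>-part of Moufang at \<open>b * j\<close>, \<open>c\<close>,
  \<open>e * j\<close>.\<close>

lemma A_B_A_A:
  assumes b: "b \<in> A" and c: "c \<in> A" and e: "e \<in> A"
  shows "((b * B c) * e) * c = b * ((c * e) * B c)"
proof -
  note mem = b c e s_A n_A B_A A_mult A_add A_mult_j V_mult_V
  have "(c * (e * j)) * c = ((c * e) * c) * j + (c * e) * B c"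
    using c e by (simp add: A_mult_Aj Aj_mult_A[of "c * e" c])
  then have "(b * j) * ((c * (e * j)) * c)
      = (b * n ((c * e) * c) + b * B ((c * e) * B c)) + (b * ((c * e) * B c)) * j"
    using mem by (simp add: Aj_mult_Aj nonassoc_distribs Aj_mult_A[of b "(c * e) * B c"] char2)
  moreover have "(((b * j) * c) * (e * j)) * c
      = (((b * c) * n e) * c + ((b * B c) * e) * B c) + (((b * B c) * e) * c) * j"
    using mem by (simp add: Aj_mult_A[of b c] A_mult_Aj Aj_mult_Aj nonassoc_distribs
        Aj_mult_A[of "(b * B c) * e" c] char2)
  ultimately have *: "(b * n ((c * e) * c) + b * B ((c * e) * B c)) + (b * ((c * e) * B c)) * j
      = (((b * c) * n e) * c + ((b * B c) * e) * B c) + (((b * B c) * e) * c) * j"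
    by (simp add: moufang)
  have "(b * ((c * e) * B c)) * j = (((b * B c) * e) * c) * j"
    by (rule components_unique(2)[OF _ _ _ _ *]) (use mem in auto)
  then show ?thesis using right_cancel j_nonzero by metis
qed

section \<open>Commutativity of \<open>j\<close>\<close>

lemma A_divide:
  assumes c: "c \<in> A" and k: "k \<in> A" "k \<noteq> 0"
  obtains e where "e \<in> A" "e * k = c"
proof -
  obtain z where z: "z * k = c" using right_inverse_ex[OF k(2)] by metis
  obtain a v where av: "a \<in> A" "v \<in> V" "z = a + v" using decomposition by blast
  obtain d where d: "d \<in> A" "v = d * j" using V_eq av by metis
  have "(a * k + d * B k) + (d * k) * j = c + 0 * j"
    using z av d by (simp add: nonassoc_distribs Aj_mult_A[of d k] char2)
  then have "(d * k) * j = 0 * j"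
    by (rule components_unique(2)[rotated -1])
      (use c k av d A_mult A_add B_A A_mult_j zero_V in auto)
  then have "d = 0" using mult_eq_0[of "d * k" j] mult_eq_0[of d k] k j_nonzero by simp
  then show ?thesis using that av d z by simp
qed

text \<open>If \<open>B\<close> does not vanish, then \<open>A\<close> is commutative, hence \<open>B (e * B c) = 0\<close> by \<open>n_mult_lin\<close>.\<close>

lemma B_eq_0:
  assumes c: "c \<in> A" shows "B c = 0"
proof (rule ccontr)
  assume k0: "B c \<noteq> 0"
  have comm: "e * d = d * e" if d: "d \<in> A" "B d \<noteq> 0" and e: "e \<in> A" for d e
  proof -
    define k where "k = B d"
    have k: "k \<in> A" "k \<noteq> 0" using B_A d by (simp_all add: k_def)
    have 1: "a * k = k * a" if "a \<in> A" for a
      using A_B_A[OF A_one d(1) that] by (simp add: k_def)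
    have "((1 * k) * e) * d = 1 * ((d * e) * k)"
      unfolding k_def by (rule A_B_A_A) (use A_one d e in auto)
    then have "(e * k) * d = (d * e) * k" using 1 e by simp
    moreover have "(e * d) * k + (e * k) * d = 0"
      using right_alternative_lin[of e d k] 1[OF d(1)] two by simp
    ultimately have "(e * d) * k + (d * e) * k = 0" by simp
    then have "(e * d) * k = (d * e) * k" by (rule eq_if_sum_eq_0)
    then show ?thesis using right_cancel k by blast
  qed
  have comm: "e * d = d * e" if d: "d \<in> A" and e: "e \<in> A" for d e
  proof (cases "B d = 0")
    \<comment> \<open>Both \<open>c\<close> and \<open>c + d\<close> have nonzero \<open>B\<close>,
      so they commute with \<open>e\<close>, and hence so does \<open>d\<close>.\<close>
    case True
    then have "e * (c + d) = (c + d) * e"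
      using comm[of "c + d" e] A_add c d e k0 by (simp add: B_add)
    moreover have "e * c = c * e" using comm c e k0 by blast
    ultimately show ?thesis by (simp add: nonassoc_distribs)
  qed (use comm d e in blast)
  obtain e where e: "e \<in> A" "e * B c = c" using A_divide[OF c B_A[OF c] k0] .
  have "n (c * e) + n (e * c) + B (e * B c) = c * n e + n e * c"
    using n_mult_lin[OF A_one c e(1)] by simp
  then have "B (e * B c) = 0"
    using comm[OF c e(1)] comm[OF c n_A[OF e(1)]] by (simp add: two)
  then show False using k0 e by simp
qed

lemma j_commutes_A: "b \<in> A \<Longrightarrow> j * b = b * j"
  by (simp add: j_mult_A B_eq_0)

text \<open>\<open>n e\<close> and \<open>e * s\<close> commute and have equal squares, so in
  characteristic two their sum squares to zero.\<close>

lemma n_eq: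
  assumes e: "e \<in> A" shows "n e = e * s"
proof -
  note mem = e s_A n_A A_mult A_mult_j
  have ne: "n e * e = e * n e"
  proof -
    have "(n e * e) * j = (j * (e * j)) * (e * j)"
      using mem by (simp add: n_def[symmetric] A_mult_Aj)
    also have "\<dots> = j * (e * n e)"
      using mem by (simp add: right_alternative Aj_mult_Aj)
    also have "\<dots> = (e * n e) * j" using mem j_commutes_A by simp
    finally show ?thesis using right_cancel j_nonzero by blast
  qed
  have n_s: "n s = s * s"
    using moufang[of j j j] by (simp add: n_def s_def[symmetric] Aj_mult_j)
  have nn: "n e * n e = n ((e * s) * e)"
  proof -
    have "n e * n e = ((j * (e * j)) * j) * (e * j)"
      using mem by (simp add: n_def[symmetric] Aj_mult_Aj)
    also have "\<dots> = j * (((e * j) * j) * (e * j))" by (rule moufang)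
    also have "\<dots> = n ((e * s) * e)"
      using mem by (simp add: Aj_mult_j A_mult_Aj) (simp add: n_def)
    finally show ?thesis .
  qed
  also have "n ((e * s) * e) = (e * n s) * e"
  proof -
    have "n ((e * s) * e) = j * ((e * (s * j)) * e)"
      using mem by (simp add: A_mult_Aj Aj_mult_A B_eq_0) (simp add: n_def)
    also have "\<dots> = ((j * e) * (s * j)) * e" by (rule moufang[symmetric])
    also have "\<dots> = (e * n s) * e"
      using mem by (simp add: j_commutes_A Aj_mult_Aj)
    finally show ?thesis .
  qed
  also have "(e * n s) * e = ((e * s) * s) * e"
    using A_A_s[of e s] mem by (simp add: n_s)
  also have "\<dots> = (e * s) * (e * s)"
    using A_s_A[of "e * s" e] mem by simp
  finally have "n e * n e = (e * s) * (e * s)" .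
  moreover have "n e * (e * s) = (e * s) * n e"
    using A_A_s[of "n e" e] A_A_s[of e "n e"] A_s_A[of e "n e"] mem by (simp add: ne)
  ultimately have "(n e + e * s) * (n e + e * s) = 0"
    by (simp add: nonassoc_distribs char2)
  then have "n e + e * s = 0" using mult_eq_0 by blast
  then show ?thesis by (rule eq_if_sum_eq_0)
qed

lemma j_commutes: "j * z = z * j"
proof -
  obtain a v where av: "a \<in> A" "v \<in> V" "z = a + v" using decomposition by blast
  obtain d where d: "d \<in> A" "v = d * j" using V_eq av by metis
  have "j * (d * j) = (d * j) * j" using n_eq[OF d(1)] by (simp add: n_def Aj_mult_j)
  then show ?thesis using av d by (simp add: nonassoc_distribs j_commutes_A)
qed

text \<open>Since \<open>j\<close> commutes with \<open>y\<close>, linearised right alternativity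
  gives \<open>(x * j) * y = (x * y) * j\<close>.\<close>

lemma associator_j: "(j * x) * y = j * (x * y)"
proof -
  have "(j * x) * y = (x * j) * y" by (simp add: j_commutes)
  also have "\<dots> = (x * y) * j"
    using right_alternative_lin[of x j y] j_commutes[of y] two eq_if_sum_eq_0 by metis
  finally show ?thesis by (simp add: j_commutes)
qed

end

section \<open>Right Moufang rings with inverses are alternative\<close>

context right_moufang_division
begin

lemma associator_eq_0_generic:
  fixes x y :: 'a
  defines "w \<equiv> assoc_map x y x"
  assumes k: "y * x - x * y \<noteq> 0" and k2: "(y * x) * x - x * (y * x) \<noteq> 0"
  shows "w = 0"
proof (rule ccontr)
  assume w0: "w \<noteq> 0"
  define A where "A = {v. assoc_map x y v = 0}"
  define V where "V = {v. assoc_map_rev x y v = 0}"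
  note kernels = A_def V_def
  have w: "w \<in> V" by (simp add: w_def V_def assoc_map_rev_assoc_map)
  obtain w' where w': "w' * w = 1"
    using right_inverse_ex[OF w0] by (auto simp: is_inverse_def)
  note d2 = assoc_map_mult_right[of x y, folded w_def]
  note d2r = assoc_map_rev_mult_right[of x y, folded w_def]
  have AV: "a * v \<in> V" if "a \<in> A" "v \<in> V" for a v
    using kernel_mult_kernel_rev[OF k] that by (simp add: kernels)
  have VV: "u * v \<in> A" if "u \<in> V" "v \<in> V" for u v
    using kernel_rev_mult_kernel_rev[OF k] that by (simp add: kernels)
  have disj: "v = 0" if "v \<in> A" "v \<in> V" for v
    using kernels_disjoint[OF k] that by (simp add: kernels)
  have decomp: "\<exists>a\<in>A. \<exists>u\<in>V. z = a + u" for z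
    by (rule kernel_decomposition[OF k, of z]) (auto simp: kernels)
  \<comment> \<open>By \<open>d2\<close> the value lies in \<open>V\<close>. On \<open>V\<close>,
    \<open>d2r\<close> reduces to \<open>- (v * w)\<close>, while the reversed map kills this
    value.\<close>
  have A2: "assoc_map x (y * x) c = 0" if c: "c \<in> A" for c
  proof -
    have "assoc_map x (y * x) c \<in> V"
      using AV[OF c w] by (simp add: d2 V_def assoc_map_rev_additive assoc_map_rev_assoc_map)
    then have "assoc_map x (y * x) c * w = 0"
      using d2r[of "assoc_map x (y * x) c"]
      by (simp add: V_def assoc_map_rev_assoc_map)
    then show ?thesis using mult_eq_0 w0 by blast
  qed
  have A2': "c \<in> A" if c: "assoc_map x (y * x) c = 0" for c
  proof -
    obtain a u where au: "a \<in> A" "u \<in> V" "c = a + u" using decomp by blast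
    have "assoc_map x (y * x) u = 0" using c A2[OF au(1)] au(3) by (simp add: assoc_map_additive)
    then have eq: "assoc_map x y (u * x) = u * w" by (simp add: d2)
    have "u * w \<in> V" unfolding eq[symmetric] by (simp add: V_def assoc_map_rev_assoc_map)
    then have "u * w = 0" using VV[OF au(2) w] disj by blast
    then have "u = 0" using mult_eq_0 w0 by blast
    then show ?thesis using au by simp
  qed
  \<comment> \<open>Chosen via \<open>d2\<close> and \<open>w' * w = 1\<close> so that
    \<open>j + 1\<close> is a value of the second map, hence in the second complement.\<close>
  define j where "j = - assoc_map x y (w' * x)"
  have j: "j \<in> V"
    by (simp add: j_def V_def assoc_map_rev_additive assoc_map_rev_assoc_map)
  have "j + 1 = assoc_map x (y * x) (- w')"
    by (simp add: j_def d2 w' assoc_map_additive)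
  then have j2: "assoc_map_rev x (y * x) (j + 1) = 0"
    by (simp only: assoc_map_rev_assoc_map)
  \<comment> \<open>Otherwise \<open>1\<close> would be in the second complement, against
    \<open>k2\<close>.\<close>
  have j0: "j \<noteq> 0"
    using j2 k2 by (auto simp: assoc_map_rev_additive)
  have one: "1 \<in> A" by (simp add: A_def assoc_map_additive)
  have shift: "(a * (j + 1)) * (b * (j + 1)) \<in> A" if "a \<in> A" "b \<in> A" for a b
    using A2' A2[OF that(1)] A2[OF that(2)] kernel_rev_mult_kernel_rev[OF k2]
      kernel_mult_kernel_rev[OF k2] j2 by blast
  have "j + j = (j + 1) * (j + 1) - (j * j + 1)"
    by (simp add: nonassoc_distribs algebra_simps)
  also have "\<dots> \<in> A"
    using shift[OF one one] VV[OF j j] one by (simp add: A_def assoc_map_additive)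
  finally have "j + j = 0"
    using j disj by (simp add: V_def assoc_map_rev_additive)
  then have "(1 + 1) * j = 0" by (simp add: nonassoc_distribs)
  then have "(1::'a) + 1 = 0" using mult_eq_0 j0 by blast
  then have two: "z + z = 0" for z :: 'a
    using nonassoc_distrib_left[of z 1 1] by simp
  have add_A: "a + b \<in> A" if "a \<in> A" "b \<in> A" for a b
    using that by (simp add: A_def assoc_map_additive)
  have add_V: "u + v \<in> V" if "u \<in> V" "v \<in> V" for u v
    using that by (simp add: V_def assoc_map_rev_additive)
  have mult_A: "a * b \<in> A" if "a \<in> A" "b \<in> A" for a b
    using kernel_mult_kernel[OF k] that by (simp add: A_def)
  interpret inseparable_doubling T A V j
    by unfold_locales (fact two add_A one mult_A add_V AV VV disj decomp j j0 shift)+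
  have "j \<in> A" using associator_j by (simp add: A_def assoc_map_def)
  then show False using disj j j0 by blast
qed

lemma left_alternative:
  fixes x y :: 'a
  shows "(x * x) * y = x * (x * y)"
proof -
  have 1: "assoc_map x y x = 0" if k: "y * x - x * y \<noteq> 0" for x y :: 'a
  proof (cases "(y * x) * x - x * (y * x) = 0")
    \<comment> \<open>Passing to \<open>x + 1\<close> changes neither the associator nor the first
      commutator, but adds the latter to the second commutator.\<close>
    case True
    define z where "z = x + 1"
    have "assoc_map z y z = 0"
    proof (rule associator_eq_0_generic)
      show "y * z - z * y \<noteq> 0" using k by (simp add: z_def nonassoc_distribs)
      have "(y * z) * z - z * (y * z)
          = ((y * x) * x - x * (y * x)) + (y * x - x * y)"
        by (simp add: z_def nonassoc_distribs algebra_simps)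
      then show "(y * z) * z - z * (y * z) \<noteq> 0" using True k by simp
    qed
    moreover have "assoc_map z y z = assoc_map x y x"
      by (simp add: z_def assoc_map_def nonassoc_distribs algebra_simps)
    ultimately show ?thesis by simp
  qed (use associator_eq_0_generic k in blast)
  have "assoc_map x y x = 0"
  proof (rule ccontr)
    assume w: "assoc_map x y x \<noteq> 0"
    \<comment> \<open>For commuting \<open>x\<close> and \<open>y\<close>, pass to
      \<open>x * y\<close>: its commutator with \<open>x\<close> is the associator up to sign, and
      the new associator is the old one times \<open>x\<close>.\<close>
    then have k: "y * x = x * y" using 1 by force
    then have "(x * y) * x - x * (x * y) = - assoc_map x y x"
      using mult_mult_commute[of x y] by simp
    then have "(x * y) * x - x * (x * y) \<noteq> 0" using w by simp
    then have "assoc_map x (x * y) x = 0" by (rule 1)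
    then have "assoc_map x y x * x = 0" by (simp add: assoc_map_mult_left)
    then have "x = 0" using mult_eq_0 w by blast
    then show False using w by (simp add: assoc_map_additive)
  qed
  then show ?thesis by (simp add: assoc_map_def)
qed

end

theorem theorem1:
  assumes "has_mult_inverses TYPE('a::nonassoc_ring_1)"
    and "hua_identity TYPE('a)"
  shows "alternative TYPE('a)"
proof -
  interpret hua_ring "TYPE('a)"
    using assms by unfold_locales
  interpret right_moufang_division "TYPE('a)"
  proof
    show "\<exists>a'. is_inverse a a' \<and> (\<forall>x. (x * a) * a' = x \<and> (x * a') * a = x)"
      if "a \<noteq> 0" for a :: 'a
      using inverse_exists[OF that] right_inverse_property[OF that] right_inverse_property'[OF that]
      by metis
  qed (rule right_moufang_if_hua)
  show ?thesis
    by (simp add: alternative_def left_alternative right_alternative)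
qed

end
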